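(* Let $\gamma_t=(p_t,\tau_t^2,\sigma_t^2,\delta_{0t},\delta_{At})$, $t=1,2,\dots$, be a sequence of parameter vectors such that, with $u=\tau^2/\sigma^2$, $f=(1-p)/p$, $\delta=\delta_0/\delta_A$ and $v=uf^2\delta^2$ (index $t$ suppressed), one has as $t\to\infty$: $p\to 0$, $u\to\infty$, $v\to\infty$ and $\frac{\log v}{u}\to C\in(0,\infty)$. For $\alpha\in(0,1)$ put $r_\alpha=\frac{\alpha}{1-\alpha}$. (a) A fixed threshold rule with BFDR at the level $\alpha=\alpha_t$ such that $r_\alpha\propto(\delta\sqrt u)^{-1}$ is ABOS. (b) Specifically, if (with $t=m$ the number of tests) $m\to\infty$, $p\propto m^{-\beta}$ for some $\beta>0$, and $\frac{\log\delta}{\log m}\to C_\delta\in[0,\infty]$, then a fixed threshold rule with BFDR at the level $\alpha$ such that $r_\alpha\propto\left(\delta\sqrt{\log(m\delta)}\right)^{-1}$ is ABOS.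
   Context: Model. Given a number of tests $m\ge 1$ and parameters $p\in(0,1)$, $\sigma^2>0$, $\tau^2>0$, let $(\nu_i,X_i)$, $i=1,\dots,m$, be i.i.d. with $P(\nu_i=1)=p=1-P(\nu_i=0)$, $X_i\mid\nu_i=0\sim N(0,\sigma^2)$ and $X_i\mid\nu_i=1\sim N(0,\sigma^2+\tau^2)$. Only the $X_i$ are observed. The null hypothesis $H_{0i}$ is the event $\nu_i=0$, the alternative $H_{Ai}$ is $\nu_i=1$. A type I error (rejecting a true $H_{0i}$) costs $\delta_0>0$, a type II error (accepting $H_{0i}$ when $H_{Ai}$ holds) costs $\delta_A>0$, and the total loss is the sum over the $m$ tests. The Bayes risk of a multiple testing rule is $R=\delta_0E(V)+\delta_AE(T)$, where $V$ is the number of false rejections and $T$ the number of false acceptances; for a rule applying one fixed threshold in all tests, $R=m((1-p)t_1\delta_0+p\,t_2\delta_A)$ with $t_1,t_2$ the probabilities of type I and type II errors in a single test. Bayes oracle: the rule minimizing $R$; it rejects $H_{0i}$ iff $X_i^2/\sigma^2\ge(1+\frac1u)\left(\log v+\log(1+\frac1u)\right)$, where $u=\tau^2/\sigma^2$, $f=(1-p)/p$, $\delta=\delta_0/\delta_A$, $v=uf^2\delta^2$. Its Bayes risk is denoted $R_{\mathrm{opt}}$. ABOS (asymptotically Bayes optimal under sparsity): a rule with risk $R$ is ABOS for the sequence $\gamma_t$ if $R/R_{\mathrm{opt}}\to1$ as $t\to\infty$. A fixed threshold rule rejects $H_{0i}$ iff $X_i^2/\sigma^2\ge c^2$. Its BFDR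 (Bayesian False Discovery Rate) is $P(H_{0i}\text{ true}\mid H_{0i}\text{ rejected})=\frac{(1-p)t_1}{(1-p)t_1+p(1-t_2)}$; it decreases continuously from $1-p$ at $c=0$ to $0$ as $c\to\infty$, so each level $\alpha\in(0,1-p]$ corresponds to exactly one threshold $c\ge0$ (the level $\alpha_t$ need lie in this range only for large $t$). $a_t\propto b_t$ means that $a_t/b_t$ converges to a constant in $(0,\infty)$. *)

theory Defs
  imports "HOL-Probability.Probability"
begin

text \<open>The fields \<open>sigma2\<close> and \<open>tau2\<close> are variances.\<close>

record params =
  p :: real
  tau2 :: real
  sigma2 :: real
  delta0 :: real
  deltaA :: real

definition admissible :: "params \<Rightarrow> bool" where
  "admissible g \<longleftrightarrow> 0 < p g \<and> p g < 1 \<and> 0 < tau2 g \<and> 0 < sigma2 g \<and> 0 < delta0 g \<and> 0 < deltaA g"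

definition u_of :: "params \<Rightarrow> real" where
  "u_of g = tau2 g / sigma2 g"

definition f_of :: "params \<Rightarrow> real" where
  "f_of g = (1 - p g) / p g"

definition delta_of :: "params \<Rightarrow> real" where
  "delta_of g = delta0 g / deltaA g"

definition v_of :: "params \<Rightarrow> real" where
  "v_of g = u_of g * (f_of g)\<^sup>2 * (delta_of g)\<^sup>2"

text \<open>
  Joint law of one pair \<open>(\<nu>, X)\<close>, where \<open>\<nu> = True\<close> encodes \<open>\<nu> = 1\<close>, i.e. that the alternative holds.
  The density with respect to the law of \<open>\<nu>\<close> times Lebesgue measure is the conditional density of \<open>X\<close>
  given \<open>\<nu>\<close>. The second argument of \<^const>\<open>normal_density\<close> is a standard deviation.
\<close>

definition test_model :: "params \<Rightarrow> (bool \<times> real) measure" where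
  "test_model g = density (measure_pmf (bernoulli_pmf (p g)) \<Otimes>\<^sub>M lborel)
     (\<lambda>(\<nu>, x). ennreal (normal_density 0 (sqrt (if \<nu> then sigma2 g + tau2 g else sigma2 g)) x))"

definition mt_model :: "nat \<Rightarrow> params \<Rightarrow> (nat \<Rightarrow> bool \<times> real) measure" where
  "mt_model m g = (\<Pi>\<^sub>M i\<in>{1..m}. test_model g)"

text \<open>A rule maps the observed vector \<open>x\<close> to its decisions; \<open>\<phi> x i\<close> means that \<open>H\<^sub>0\<^sub>i\<close> is rejected.\<close>

type_synonym mt_rule = "(nat \<Rightarrow> real) \<Rightarrow> nat \<Rightarrow> bool"

definition mt_rules :: "nat \<Rightarrow> mt_rule set" where
  "mt_rules m = {\<phi>. \<forall>i\<in>{1..m}. (\<lambda>x. \<phi> x i) \<in> measurable (\<Pi>\<^sub>M j\<in>{1..m}. borel) (count_space UNIV)}"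

definition observed :: "nat \<Rightarrow> (nat \<Rightarrow> bool \<times> real) \<Rightarrow> nat \<Rightarrow> real" where
  "observed m \<omega> = (\<lambda>i\<in>{1..m}. snd (\<omega> i))"

definition false_rejections :: "nat \<Rightarrow> mt_rule \<Rightarrow> (nat \<Rightarrow> bool \<times> real) \<Rightarrow> nat" where
  "false_rejections m \<phi> \<omega> = card {i\<in>{1..m}. \<not> fst (\<omega> i) \<and> \<phi> (observed m \<omega>) i}"

definition false_acceptances :: "nat \<Rightarrow> mt_rule \<Rightarrow> (nat \<Rightarrow> bool \<times> real) \<Rightarrow> nat" where
  "false_acceptances m \<phi> \<omega> = card {i\<in>{1..m}. fst (\<omega> i) \<and> \<not> \<phi> (observed m \<omega>) i}"

definition bayes_risk :: "nat \<Rightarrow> params \<Rightarrow> mt_rule \<Rightarrow> real" where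
  "bayes_risk m g \<phi> =
     delta0 g * (LINT \<omega>|mt_model m g. real (false_rejections m \<phi> \<omega>)) +
     deltaA g * (LINT \<omega>|mt_model m g. real (false_acceptances m \<phi> \<omega>))"

text \<open>
  The risk of the Bayes oracle, i.e. of the rule minimising the Bayes risk. The infimum is attained, by the
  rule rejecting \<open>H\<^sub>0\<^sub>i\<close> iff \<open>x\<^sub>i\<^sup>2 / \<sigma>\<^sup>2 \<ge> (1 + 1/u) * (ln v + ln (1 + 1/u))\<close>.
\<close>

definition R_opt :: "nat \<Rightarrow> params \<Rightarrow> real" where
  "R_opt m g = (INF \<phi>\<in>mt_rules m. bayes_risk m g \<phi>)"

definition ABOS :: "(nat \<Rightarrow> nat) \<Rightarrow> (nat \<Rightarrow> params) \<Rightarrow> (nat \<Rightarrow> mt_rule) \<Rightarrow> bool" where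
  "ABOS m \<gamma> \<phi> \<longleftrightarrow> (\<lambda>t. bayes_risk (m t) (\<gamma> t) (\<phi> t) / R_opt (m t) (\<gamma> t)) \<longlonglongrightarrow> 1"

definition fixed_threshold_rule :: "params \<Rightarrow> real \<Rightarrow> mt_rule" where
  "fixed_threshold_rule g c = (\<lambda>x i. (x i)\<^sup>2 / sigma2 g \<ge> c\<^sup>2)"

text \<open>
  BFDR of the fixed threshold rule with threshold \<open>c\<close>: the conditional probability that a hypothesis is
  true given that it is rejected. It is the same for all tests, so it is computed from the law of a single pair.
\<close>

definition BFDR :: "params \<Rightarrow> real \<Rightarrow> real" where
  "BFDR g c = \<P>(\<omega> in test_model g. \<not> fst \<omega> \<bar> (snd \<omega>)\<^sup>2 / sigma2 g \<ge> c\<^sup>2)"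

definition odds :: "real \<Rightarrow> real" where
  "odds \<alpha> = \<alpha> / (1 - \<alpha>)"

definition asymp_proportional :: "(nat \<Rightarrow> real) \<Rightarrow> (nat \<Rightarrow> real) \<Rightarrow> bool" where
  "asymp_proportional a b \<longleftrightarrow> (\<exists>K>0. (\<lambda>t. a t / b t) \<longlonglongrightarrow> K)"

end

theory Submission
  imports Defs
begin

text \<open>
  Let \<open>G(w) = P(Z\<^sup>2 \<ge> w)\<close> for a standard normal \<open>Z\<close>. A fixed threshold rule has \<open>t\<^sub>1 = G(c\<^sup>2)\<close> and
  \<open>t\<^sub>2 = 1 - G(w)\<close> with \<open>w = c\<^sup>2 / (u + 1)\<close>, so its risk is \<open>m p \<delta>\<^sub>A (f \<delta> G(c\<^sup>2) + 1 - G(w))\<close>, and the odds of its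
  BFDR are \<open>f G(c\<^sup>2) / G(w)\<close>.

  Suppose that these odds times \<open>\<delta> sqrt u\<close> converge to a positive number. Then \<open>f \<delta> G(c\<^sup>2)\<close> is
  \<open>O(1 / sqrt u)\<close>, so type I errors do not contribute in the limit. Moreover \<open>sqrt v G(c\<^sup>2) / G(w)\<close> converges to a
  positive number; as \<open>ln (G x) = - x / 2 + O(1 + sqrt x)\<close>, this forces \<open>w\<close> to converge to \<open>C\<close>
  (\<open>threshold_limit\<close>). Hence the risk divided by \<open>m p \<delta>\<^sub>A\<close> tends to \<open>1 - G(C) > 0\<close>.

  The optimal risk is not computed; it is bounded below. Where \<open>X\<^sub>i\<^sup>2 / \<sigma>\<^sup>2 < (1 + 1/u) ln v\<close>, the weighted density of
  the null hypothesis dominates that of the alternative, so no rule, even one that uses all observations for each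
  decision, does better there than to accept (\<open>rejection_cost_le\<close>). Therefore, once \<open>v \<ge> 1\<close>, every risk is at least
  \<open>m p \<delta>\<^sub>A (1 - G(ln v / u))\<close> (\<open>bayes_risk_lower_bound\<close>). As \<open>ln v / u\<close> also converges to \<open>C\<close>, both bounds
  agree in the limit (\<open>ABOS_fixed_threshold\<close>). This is part (a). Part (b) reduces to (a), because under its
  assumptions \<open>ln (m \<delta>) / u\<close> converges to a positive number (\<open>ln_m_delta_proportional\<close>).
\<close>

section \<open>The tail of the squared standard normal distribution\<close>

text \<open>
  The probability \<open>P(Z\<^sup>2 \<ge> w)\<close> for a standard normal \<open>Z\<close>. The threshold rule compares squares, so taking the
  squared threshold as the argument expresses both error probabilities by this one function.
\<close>

definition chi_tail :: "real \<Rightarrow> real" where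
  "chi_tail w = measure (density lborel (\<lambda>x. ennreal (std_normal_density x))) {z. w \<le> z\<^sup>2}"

lemma measure_normal_integral:
  assumes "0 < s" and [measurable]: "A \<in> sets borel"
  shows "measure (density lborel (\<lambda>x. ennreal (normal_density \<mu> s x))) A = (LINT x|lborel. indicator A x * normal_density \<mu> s x)"
proof -
  have "emeasure (density lborel (\<lambda>x. ennreal (normal_density \<mu> s x))) A
      = (\<integral>\<^sup>+x. ennreal (indicator A x * normal_density \<mu> s x) \<partial>lborel)"
    by (subst emeasure_density) (auto intro!: nn_integral_cong simp: indicator_def)
  then show ?thesis
    unfolding measure_def by (subst integral_eq_nn_integral) auto
qed

lemma measure_normal_scale:
  assumes "0 < s"
  shows "measure (density lborel (\<lambda>x. ennreal (normal_density 0 s x))) {x. w \<le> x\<^sup>2} = chi_tail (w / s\<^sup>2)"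
proof -
  have "(LINT x|lborel. indicator {x. w \<le> x\<^sup>2} x * normal_density 0 s x)
      = \<bar>s\<bar> *\<^sub>R (LINT x|lborel. indicator {x. w \<le> x\<^sup>2} (0 + s * x) * normal_density 0 s (0 + s * x))"
    using assms by (intro lborel_integral_real_affine) simp
  also have "\<dots> = (LINT x|lborel. s * (indicator {x. w \<le> x\<^sup>2} (0 + s * x) * normal_density 0 s (0 + s * x)))"
    using assms by simp
  also have "\<dots> = (LINT x|lborel. indicator {x. w / s\<^sup>2 \<le> x\<^sup>2} x * std_normal_density x)"
    using assms
    by (intro Bochner_Integration.integral_cong)
      (auto simp: indicator_def normal_density_def field_simps power_mult_distrib real_sqrt_mult)
  finally show ?thesis
    using assms by (simp add: chi_tail_def measure_normal_integral)
qed

lemma chi_tail_integral: "chi_tail w = (LINT x|lborel. indicator {z. w \<le> z\<^sup>2} x * std_normal_density x)"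
  unfolding chi_tail_def by (rule measure_normal_integral) auto

text \<open>
  A Chernoff-type bound: if \<open>\<bar>x\<bar> \<ge> y \<ge> 0\<close>, then \<open>x\<^sup>2 \<ge> y\<^sup>2 + (\<bar>x\<bar> - y)\<^sup>2\<close>, so the standard normal density at \<open>x\<close> is at
  most \<open>exp (- y\<^sup>2 / 2)\<close> times the normal density centred at \<open>y\<close> or at \<open>- y\<close>.
\<close>

lemma chi_tail_le_exp:
  assumes "0 \<le> y"
  shows "chi_tail (y\<^sup>2) \<le> 2 * exp (- y\<^sup>2 / 2)"
proof -
  have le: "indicator {z. y\<^sup>2 \<le> z\<^sup>2} x * std_normal_density x
      \<le> exp (- y\<^sup>2 / 2) * (normal_density y 1 x + normal_density (- y) 1 x)" for x
  proof (cases "y\<^sup>2 \<le> x\<^sup>2")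
    case True
    then have "y \<le> \<bar>x\<bar>" using assms by (simp add: abs_le_square_iff[symmetric])
    then consider "y \<le> x" | "y \<le> - x" by linarith
    then show ?thesis
    proof cases
      case 1
      have "0 \<le> y * (x - y)" using 1 assms by simp
      then have "- x\<^sup>2 / 2 \<le> - y\<^sup>2 / 2 + - (x - y)\<^sup>2 / 2"
        by (simp add: power2_eq_square algebra_simps)
      then have "std_normal_density x \<le> exp (- y\<^sup>2 / 2) * normal_density y 1 x"
        by (simp add: normal_density_def exp_add[symmetric] divide_right_mono)
      also have "\<dots> \<le> exp (- y\<^sup>2 / 2) * (normal_density y 1 x + normal_density (- y) 1 x)"
        by (intro mult_left_mono) auto
      finally show ?thesis using True by simp
    next
      case 2
      have "0 \<le> y * (- x - y)" using 2 assms by (intro mult_nonneg_nonneg) auto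
      then have "- x\<^sup>2 / 2 \<le> - y\<^sup>2 / 2 + - (x + y)\<^sup>2 / 2"
        by (simp add: power2_eq_square algebra_simps)
      then have "std_normal_density x \<le> exp (- y\<^sup>2 / 2) * normal_density (- y) 1 x"
        by (simp add: normal_density_def exp_add[symmetric] divide_right_mono)
      also have "\<dots> \<le> exp (- y\<^sup>2 / 2) * (normal_density y 1 x + normal_density (- y) 1 x)"
        by (intro mult_left_mono) auto
      finally show ?thesis using True by simp
    qed
  qed simp
  have "chi_tail (y\<^sup>2) \<le> (LINT x|lborel. exp (- y\<^sup>2 / 2) * (normal_density y 1 x + normal_density (- y) 1 x))"
    unfolding chi_tail_integral
  proof (rule integral_mono[OF _ _ le])
    show "integrable lborel (\<lambda>x. indicator {z. y\<^sup>2 \<le> z\<^sup>2} x * std_normal_density x)"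
      by (rule Bochner_Integration.integrable_bound[OF integrable_normal_density[of 1 0]])
        (auto simp: indicator_def)
  qed auto
  also have "\<dots> = 2 * exp (- y\<^sup>2 / 2)" by simp
  finally show ?thesis .
qed

text \<open>The interval from \<open>y\<close> to \<open>y + 1\<close> alone carries this much mass.\<close>

lemma chi_tail_ge_exp:
  assumes "0 \<le> y"
  shows "exp (- (y + 1)\<^sup>2 / 2) / sqrt (2 * pi) \<le> chi_tail (y\<^sup>2)"
proof -
  have "exp (- (y + 1)\<^sup>2 / 2) / sqrt (2 * pi)
      = (LINT x|lborel. (exp (- (y + 1)\<^sup>2 / 2) / sqrt (2 * pi)) * indicator {y..y+1} x)"
    by simp
  also have "\<dots> \<le> chi_tail (y\<^sup>2)"
    unfolding chi_tail_integral
  proof (rule integral_mono)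
    show "integrable lborel (\<lambda>x. indicator {z. y\<^sup>2 \<le> z\<^sup>2} x * std_normal_density x)"
      by (rule Bochner_Integration.integrable_bound[OF integrable_normal_density[of 1 0]])
        (auto simp: indicator_def)
    show "(exp (- (y + 1)\<^sup>2 / 2) / sqrt (2 * pi)) * indicator {y..y+1} x
      \<le> indicator {z. y\<^sup>2 \<le> z\<^sup>2} x * std_normal_density x" for x
    proof (cases "x \<in> {y..y+1}")
      case True
      then have "y\<^sup>2 \<le> x\<^sup>2" "x\<^sup>2 \<le> (y + 1)\<^sup>2" using assms by (auto intro!: power_mono)
      then show ?thesis using True by (simp add: std_normal_density_def divide_right_mono)
    qed auto
  qed simp
  finally show ?thesis .
qed

lemma chi_tail_pos: "0 \<le> w \<Longrightarrow> 0 < chi_tail w"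
  using chi_tail_ge_exp[of "sqrt w"] by (auto intro: less_le_trans[rotated])

lemma chi_tail_less_1:
  assumes "0 < w"
  shows "chi_tail w < 1"
proof -
  interpret N: prob_space "density lborel (\<lambda>x. ennreal (std_normal_density x))"
    by (rule prob_space_normal_density) simp
  define s where "s = sqrt w"
  have s: "0 < s" "w = s\<^sup>2" using assms by (auto simp: s_def)
  have "0 < s * (exp (- s\<^sup>2 / 2) / sqrt (2 * pi))" using s by simp
  also have "\<dots> = (LINT x|lborel. (exp (- s\<^sup>2 / 2) / sqrt (2 * pi)) * indicator {0..<s} x)"
    using s by simp
  also have "\<dots> \<le> (LINT x|lborel. indicator {z. z\<^sup>2 < w} x * std_normal_density x)"
  proof (rule integral_mono)
    show "integrable lborel (\<lambda>x. indicator {z. z\<^sup>2 < w} x * std_normal_density x)"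
      by (rule Bochner_Integration.integrable_bound[OF integrable_normal_density[of 1 0]])
        (auto simp: indicator_def)
    show "integrable lborel (\<lambda>x. (exp (- s\<^sup>2 / 2) / sqrt (2 * pi)) * indicator {0..<s} x)"
      by (intro integrable_mult_right integrable_real_indicator) (use s in auto)
    show "(exp (- s\<^sup>2 / 2) / sqrt (2 * pi)) * indicator {0..<s} x
      \<le> indicator {z. z\<^sup>2 < w} x * std_normal_density x" for x
    proof (cases "x \<in> {0..<s}")
      case True
      then have "x\<^sup>2 < s\<^sup>2" using s by (intro power_strict_mono) auto
      then show ?thesis using True s by (simp add: std_normal_density_def divide_right_mono)
    qed (auto simp: indicator_def)
  qed
  also have "\<dots> = N.prob {z. z\<^sup>2 < w}"
    by (subst measure_normal_integral) auto
  also have "\<dots> = 1 - chi_tail w"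
    unfolding chi_tail_def
    by (subst N.prob_compl[symmetric]) (auto intro!: arg_cong[where f=N.prob])
  finally show ?thesis by simp
qed

lemma chi_tail_tendsto:
  assumes "w \<longlonglongrightarrow> C" "0 < C"
  shows "(\<lambda>n. chi_tail (w n)) \<longlonglongrightarrow> chi_tail C"
  unfolding chi_tail_integral
proof (rule integral_dominated_convergence)
  show "integrable lborel (std_normal_density)" by simp
  \<comment> \<open>The indicators converge except where \<open>x\<^sup>2 = C\<close>, which is a null set.\<close>
  have "AE x in lborel. x \<notin> {sqrt C, - sqrt C}"
    by (intro AE_not_in finite_imp_null_set_lborel) auto
  then show "AE x in lborel. (\<lambda>n. indicator {z. w n \<le> z\<^sup>2} x * std_normal_density x)
      \<longlonglongrightarrow> indicator {z. C \<le> z\<^sup>2} x * std_normal_density x"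
  proof eventually_elim
    case (elim x)
    then have "x\<^sup>2 \<noteq> C" using assms(2) by (auto simp: real_sqrt_abs)
    then consider "C < x\<^sup>2" | "x\<^sup>2 < C" by linarith
    then have "\<forall>\<^sub>F n in sequentially. (indicator {z. w n \<le> z\<^sup>2} x :: real) = indicator {z. C \<le> z\<^sup>2} x"
    proof cases
      case 1
      show ?thesis using order_tendstoD(2)[OF assms(1) 1]
        by eventually_elim (use 1 in \<open>auto simp: indicator_def\<close>)
    next
      case 2
      show ?thesis using order_tendstoD(1)[OF assms(1) 2]
        by eventually_elim (use 2 in \<open>auto simp: indicator_def\<close>)
    qed
    then have "(\<lambda>n. indicator {z. w n \<le> z\<^sup>2} x :: real) \<longlonglongrightarrow> indicator {z. C \<le> z\<^sup>2} x"
      by (rule tendsto_eventually)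
    then show ?case by (rule tendsto_mult_right)
  qed
qed (auto simp: indicator_def)

text \<open>
  The logarithm of the tail is \<open>- x / 2\<close> up to an error of order \<open>sqrt x\<close>. The bound holds for all \<open>x \<ge> 0\<close>, so it
  applies to thresholds about which nothing is known yet.
\<close>

lemma ln_chi_tail_bound:
  "\<exists>B. \<forall>x\<ge>0. \<bar>ln (chi_tail x) + x / 2\<bar> \<le> sqrt x + B"
proof (intro exI allI impI)
  fix x :: real assume "0 \<le> x"
  define y where "y = sqrt x"
  have y: "0 \<le> y" "x = y\<^sup>2" using \<open>0 \<le> x\<close> by (auto simp: y_def)
  have "ln (chi_tail x) \<le> ln (2 * exp (- y\<^sup>2 / 2))"
    using chi_tail_le_exp[OF y(1)] chi_tail_pos[OF \<open>0 \<le> x\<close>] y by simp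
  then have 1: "ln (chi_tail x) \<le> ln 2 - x / 2" by (simp add: ln_mult y)
  have "ln (exp (- (y + 1)\<^sup>2 / 2) / sqrt (2 * pi)) \<le> ln (chi_tail x)"
    using chi_tail_ge_exp[OF y(1)] chi_tail_pos[OF \<open>0 \<le> x\<close>] y by (subst ln_le_cancel_iff) auto
  then have 2: "- x / 2 - y - 1 / 2 - ln (sqrt (2 * pi)) \<le> ln (chi_tail x)"
    by (simp add: ln_div y power2_eq_square algebra_simps add_divide_distrib diff_divide_distrib)
  have "0 \<le> ln (sqrt (2 * pi))" "0 \<le> ln (2::real)" using pi_ge_two by auto
  then show "\<bar>ln (chi_tail x) + x / 2\<bar> \<le> sqrt x + (1 / 2 + ln 2 + ln (sqrt (2 * pi)))"
    using 1 2 y(1) unfolding y_def by linarith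
qed

section \<open>The threshold determined by the false discovery rate\<close>

text \<open>
  The convergence to \<open>K\<close> is the BFDR condition: with \<open>v = u f\<^sup>2 \<delta>\<^sup>2\<close> the sequence is \<open>\<delta> sqrt u\<close> times the odds of
  the BFDR. Taking logarithms gives \<open>ln v - c\<^sup>2 + w = O(1 + \<bar>c\<bar>)\<close> with \<open>w = c\<^sup>2 / (u + 1)\<close>; division by \<open>u\<close> yields
  \<open>\<bar>w - ln v / u\<bar> \<le> e (w + 1)\<close> with \<open>e\<close> tending to 0. Such an estimate first bounds \<open>w\<close> and then forces it
  to converge to the limit of \<open>ln v / u\<close>.
\<close>

lemma threshold_limit:
  fixes u v c :: "nat \<Rightarrow> real"
  assumes u: "filterlim u at_top sequentially"
    and v: "filterlim v at_top sequentially"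
    and C: "(\<lambda>t. ln (v t) / u t) \<longlonglongrightarrow> C"
    and K: "(\<lambda>t. sqrt (v t) * chi_tail ((c t)\<^sup>2) / chi_tail ((c t)\<^sup>2 / (u t + 1))) \<longlonglongrightarrow> K" "0 < K"
  shows "(\<lambda>t. (c t)\<^sup>2 / (u t + 1)) \<longlonglongrightarrow> C"
proof -
  define w where "w t = (c t)\<^sup>2 / (u t + 1)" for t
  define l where "l t = ln (v t) / u t" for t
  define k where "k t = sqrt (v t) * chi_tail ((c t)\<^sup>2) / chi_tail (w t)" for t
  obtain B where B: "\<And>x. 0 \<le> x \<Longrightarrow> \<bar>ln (chi_tail x) + x / 2\<bar> \<le> sqrt x + B"
    using ln_chi_tail_bound by blast
  define e where "e t = (2 * \<bar>ln (k t)\<bar> + 4 * B) / u t + 4 * sqrt (u t + 1) / u t" for t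
  have u1: "\<forall>\<^sub>F t in sequentially. 1 \<le> u t" using u by (auto simp: filterlim_at_top)
  have v1: "\<forall>\<^sub>F t in sequentially. 1 \<le> v t" using v by (auto simp: filterlim_at_top)
  have "((\<lambda>x::real. 4 * sqrt (x + 1) / x) \<longlongrightarrow> 0) at_top" by real_asymp
  then have e2: "(\<lambda>t. 4 * sqrt (u t + 1) / u t) \<longlonglongrightarrow> 0"
    by (rule filterlim_compose[OF _ u])
  have "k \<longlonglongrightarrow> K" using K(1) by (simp add: k_def[abs_def] w_def)
  then have "(\<lambda>t. 2 * \<bar>ln (k t)\<bar> + 4 * B) \<longlonglongrightarrow> 2 * \<bar>ln K\<bar> + 4 * B"
    using K(2) by (auto intro!: tendsto_intros)
  then have e1: "(\<lambda>t. (2 * \<bar>ln (k t)\<bar> + 4 * B) / u t) \<longlonglongrightarrow> 0"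
    using filterlim_at_top_imp_at_infinity[OF u] by (rule tendsto_divide_0)
  have e0: "e \<longlonglongrightarrow> 0" using tendsto_add[OF e1 e2] by (simp add: e_def[abs_def])
  have main: "\<forall>\<^sub>F t in sequentially. \<bar>w t - l t\<bar> \<le> e t * (w t + 1)"
    using u1 v1
  proof eventually_elim
    case (elim t)
    let ?x = "(c t)\<^sup>2"
    have w0: "0 \<le> w t" using elim by (simp add: w_def)
    have x: "?x = (u t + 1) * w t" using elim by (simp add: w_def)
    have pos: "0 < chi_tail ?x" "0 < chi_tail (w t)" using w0 by (auto intro: chi_tail_pos)
    have lnk: "ln (k t) = ln (v t) / 2 + ln (chi_tail ?x) - ln (chi_tail (w t))"
      using pos elim by (simp add: k_def ln_div ln_mult ln_sqrt)
    have sx: "sqrt ?x = sqrt (u t + 1) * sqrt (w t)" unfolding x by (simp add: real_sqrt_mult)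
    have sw: "sqrt (w t) \<le> w t + 1"
    proof (rule real_le_lsqrt)
      show "w t \<le> (w t + 1)\<^sup>2" using w0 by (simp add: power2_eq_square algebra_simps)
    qed (use w0 in auto)
    have s1: "1 \<le> sqrt (u t + 1)" using elim by simp
    have "sqrt (w t) \<le> sqrt (u t + 1) * sqrt (w t)"
      using s1 w0 by (simp add: mult_le_cancel_right1)
    moreover have "sqrt (u t + 1) * sqrt (w t) \<le> sqrt (u t + 1) * (w t + 1)"
      using sw s1 by (intro mult_left_mono) auto
    ultimately have ss: "sqrt ?x + sqrt (w t) \<le> 2 * (sqrt (u t + 1) * (w t + 1))"
      unfolding sx by linarith
    have "ln (v t) / 2 - u t * w t / 2
        = ln (k t) - (ln (chi_tail ?x) + ?x / 2) + (ln (chi_tail (w t)) + w t / 2)"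
      unfolding lnk by (simp add: x algebra_simps add_divide_distrib)
    then have "\<bar>ln (v t) / 2 - u t * w t / 2\<bar> \<le> \<bar>ln (k t)\<bar> + (sqrt ?x + B) + (sqrt (w t) + B)"
      using B[of ?x] B[OF w0] by simp
    then have "\<bar>ln (v t) - u t * w t\<bar> \<le> 2 * \<bar>ln (k t)\<bar> + 4 * B + 4 * sqrt (u t + 1) * (w t + 1)"
      using ss by linarith
    moreover have "0 \<le> B" using B[of 0] by simp
    then have "2 * \<bar>ln (k t)\<bar> + 4 * B \<le> (2 * \<bar>ln (k t)\<bar> + 4 * B) * (w t + 1)"
      using w0 by (simp add: algebra_simps)
    ultimately have "\<bar>ln (v t) - u t * w t\<bar> \<le> (2 * \<bar>ln (k t)\<bar> + 4 * B + 4 * sqrt (u t + 1)) * (w t + 1)"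
      by (simp add: algebra_simps)
    moreover have "\<bar>w t - l t\<bar> = \<bar>ln (v t) - u t * w t\<bar> / u t"
    proof -
      have "w t - l t = - (ln (v t) - u t * w t) / u t"
        using elim by (simp add: l_def field_simps)
      then show ?thesis using elim by (simp add: abs_divide)
    qed
    ultimately show ?case
      using elim by (simp add: e_def divide_right_mono flip: add_divide_distrib)
  qed
  have l: "l \<longlonglongrightarrow> C" using C by (simp add: l_def[abs_def])
  \<comment> \<open>As soon as \<open>e < 1/2\<close>, the estimate bounds \<open>w\<close> by \<open>2 l + 1\<close>, so its right-hand side tends to 0.\<close>
  have "\<forall>\<^sub>F t in sequentially. e t < 1 / 2" using order_tendstoD(2)[OF e0, of "1/2"] by simp
  then have "\<forall>\<^sub>F t in sequentially. norm (w t - l t) \<le> e t * (2 * l t + 2)"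
    using main u1
  proof eventually_elim
    case (elim t)
    have w0: "0 \<le> w t" using elim by (simp add: w_def)
    have "0 \<le> e t * (w t + 1)" using elim by linarith
    then have e: "0 \<le> e t" using w0 by (simp add: zero_le_mult_iff)
    have "e t * (w t + 1) \<le> 1 / 2 * (w t + 1)" using elim w0 by (intro mult_right_mono) auto
    moreover have "w t - l t \<le> e t * (w t + 1)" using elim by simp
    ultimately have "w t - l t \<le> 1 / 2 * (w t + 1)" by (rule order_trans[rotated])
    then have "w t \<le> 2 * l t + 1" by (simp add: field_simps)
    then have "e t * (w t + 1) \<le> e t * (2 * l t + 2)" using e by (intro mult_left_mono) auto
    then show ?case using elim by simp
  qed
  moreover have "(\<lambda>t. e t * (2 * l t + 2)) \<longlonglongrightarrow> 0"
    using tendsto_mult[OF e0 tendsto_add[OF tendsto_mult[OF tendsto_const l] tendsto_const], of 2 2]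
    unfolding mult_zero_left .
  ultimately have "(\<lambda>t. w t - l t) \<longlonglongrightarrow> 0"
    by (rule Lim_null_comparison)
  from tendsto_add[OF this l] have "w \<longlonglongrightarrow> C" by simp
  then show ?thesis by (simp add: w_def[abs_def])
qed

section \<open>The law of a single test\<close>

text \<open>The centred normal distribution with standard deviation \<open>s\<close>.\<close>

abbreviation normal_law :: "real \<Rightarrow> real measure" where
  "normal_law s \<equiv> density lborel (\<lambda>x. ennreal (normal_density 0 s x))"

lemma sets_test_model [measurable_cong]: "sets (test_model g) = sets (count_space UNIV \<Otimes>\<^sub>M borel)"
  unfolding test_model_def sets_density by (rule sets_pair_measure_cong) auto

lemma space_test_model [simp]: "space (test_model g) = UNIV"
  using sets_eq_imp_space_eq[OF sets_test_model] by (simp add: space_pair_measure)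

lemma test_events:
  assumes "A \<in> sets borel"
  shows "{\<omega>. fst \<omega> \<and> snd \<omega> \<in> A} \<in> sets (count_space UNIV \<Otimes>\<^sub>M borel)"
    and "{\<omega>. \<not> fst \<omega> \<and> snd \<omega> \<in> A} \<in> sets (count_space UNIV \<Otimes>\<^sub>M borel)"
proof -
  have "{\<omega>. fst \<omega> \<and> snd \<omega> \<in> A} = {True} \<times> A" "{\<omega>. \<not> fst \<omega> \<and> snd \<omega> \<in> A} = {False} \<times> A" by auto
  then show "{\<omega>. fst \<omega> \<and> snd \<omega> \<in> A} \<in> sets (count_space UNIV \<Otimes>\<^sub>M borel)"
    and "{\<omega>. \<not> fst \<omega> \<and> snd \<omega> \<in> A} \<in> sets (count_space UNIV \<Otimes>\<^sub>M borel)"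
    using assms by (auto intro!: pair_measureI)
qed

lemma nn_integral_test_model:
  assumes "0 \<le> p g" "p g \<le> 1"
    and f[measurable]: "f \<in> borel_measurable (count_space UNIV \<Otimes>\<^sub>M borel)"
  shows "(\<integral>\<^sup>+\<omega>. f \<omega> \<partial>test_model g) =
    ennreal (p g) * (\<integral>\<^sup>+x. f (True, x) \<partial>normal_law (sqrt (sigma2 g + tau2 g))) +
    ennreal (1 - p g) * (\<integral>\<^sup>+x. f (False, x) \<partial>normal_law (sqrt (sigma2 g)))"
proof -
  let ?d = "\<lambda>(\<nu>, x). ennreal (normal_density 0 (sqrt (if \<nu> then sigma2 g + tau2 g else sigma2 g)) x)"
  have [measurable_cong]: "sets (measure_pmf (bernoulli_pmf (p g)) \<Otimes>\<^sub>M lborel) = sets (count_space UNIV \<Otimes>\<^sub>M borel)"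
    by (rule sets_pair_measure_cong) auto
  have [measurable]: "?d \<in> borel_measurable (measure_pmf (bernoulli_pmf (p g)) \<Otimes>\<^sub>M lborel)"
    unfolding normal_density_def by measurable
  have "(\<integral>\<^sup>+\<omega>. f \<omega> \<partial>test_model g) = (\<integral>\<^sup>+\<omega>. ?d \<omega> * f \<omega> \<partial>(measure_pmf (bernoulli_pmf (p g)) \<Otimes>\<^sub>M lborel))"
    unfolding test_model_def by (rule nn_integral_density) auto
  also have "\<dots> = (\<integral>\<^sup>+\<nu>. \<integral>\<^sup>+x. ?d (\<nu>, x) * f (\<nu>, x) \<partial>lborel \<partial>measure_pmf (bernoulli_pmf (p g)))"
    by (rule lborel.nn_integral_fst[symmetric]) measurable
  also have "\<dots> = (\<integral>\<^sup>+x. ?d (True, x) * f (True, x) \<partial>lborel) * ennreal (p g)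
      + (\<integral>\<^sup>+x. ?d (False, x) * f (False, x) \<partial>lborel) * ennreal (1 - p g)"
    using assms(1,2) by (subst nn_integral_bernoulli_pmf) auto
  finally show ?thesis
    by (simp add: nn_integral_density mult.commute)
qed

lemma prob_space_normal_law: "0 < s \<Longrightarrow> prob_space (normal_law s)"
  by (rule prob_space_normal_density)

lemma prob_space_test_model:
  assumes "admissible g"
  shows "prob_space (test_model g)"
proof
  have 1: "emeasure (normal_law s) UNIV = 1" if "0 < s" for s
    using prob_space.emeasure_space_1[OF prob_space_normal_law[OF that]] by simp
  have "emeasure (test_model g) (space (test_model g)) = (\<integral>\<^sup>+\<omega>. 1 \<partial>test_model g)" by simp
  also have "\<dots> = 1"
    using assms by (subst nn_integral_test_model) (auto simp: admissible_def 1 ennreal_plus[symmetric] simp del: ennreal_plus)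
  finally show "emeasure (test_model g) (space (test_model g)) = 1" .
qed

lemma measure_test_model:
  assumes g: "admissible g" and [measurable]: "A \<in> sets borel"
  shows "measure (test_model g) {\<omega>. fst \<omega> \<and> snd \<omega> \<in> A} = p g * measure (normal_law (sqrt (sigma2 g + tau2 g))) A"
    and "measure (test_model g) {\<omega>. \<not> fst \<omega> \<and> snd \<omega> \<in> A} = (1 - p g) * measure (normal_law (sqrt (sigma2 g))) A"
proof -
  have ps: "prob_space (normal_law (sqrt (sigma2 g + tau2 g)))" "prob_space (normal_law (sqrt (sigma2 g)))"
    using g by (auto intro!: prob_space_normal_law simp: admissible_def)
  interpret A: prob_space "normal_law (sqrt (sigma2 g + tau2 g))" by fact
  interpret N: prob_space "normal_law (sqrt (sigma2 g))" by fact
  interpret T: prob_space "test_model g" by (rule prob_space_test_model[OF g])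
  note [measurable] = test_events[OF assms(2)]
  have sec_True: "(\<lambda>x. indicator {\<omega>. fst \<omega> \<and> snd \<omega> \<in> A} (True, x) :: ennreal) = indicator A"
    "(\<lambda>x. indicator {\<omega>. fst \<omega> \<and> snd \<omega> \<in> A} (False, x) :: ennreal) = (\<lambda>_. 0)"
    by (auto simp: indicator_def)
  have "emeasure (test_model g) {\<omega>. fst \<omega> \<and> snd \<omega> \<in> A} = (\<integral>\<^sup>+\<omega>. indicator {\<omega>. fst \<omega> \<and> snd \<omega> \<in> A} \<omega> \<partial>test_model g)"
    by (subst nn_integral_indicator) (auto simp: sets_test_model)
  also have "\<dots> = ennreal (p g) * (\<integral>\<^sup>+x. indicator {\<omega>. fst \<omega> \<and> snd \<omega> \<in> A} (True, x) \<partial>normal_law (sqrt (sigma2 g + tau2 g)))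
      + ennreal (1 - p g) * (\<integral>\<^sup>+x. indicator {\<omega>. fst \<omega> \<and> snd \<omega> \<in> A} (False, x) \<partial>normal_law (sqrt (sigma2 g)))"
    using g by (intro nn_integral_test_model) (auto simp: admissible_def)
  also have "\<dots> = ennreal (p g * A.prob A)"
    unfolding sec_True
    using g by (simp add: A.emeasure_eq_measure ennreal_mult admissible_def)
  finally show "T.prob {\<omega>. fst \<omega> \<and> snd \<omega> \<in> A} = p g * A.prob A"
    using g by (simp add: T.emeasure_eq_measure admissible_def)
  have sec_False: "(\<lambda>x. indicator {\<omega>. \<not> fst \<omega> \<and> snd \<omega> \<in> A} (False, x) :: ennreal) = indicator A"
    "(\<lambda>x. indicator {\<omega>. \<not> fst \<omega> \<and> snd \<omega> \<in> A} (True, x) :: ennreal) = (\<lambda>_. 0)"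
    by (auto simp: indicator_def)
  have "emeasure (test_model g) {\<omega>. \<not> fst \<omega> \<and> snd \<omega> \<in> A} = (\<integral>\<^sup>+\<omega>. indicator {\<omega>. \<not> fst \<omega> \<and> snd \<omega> \<in> A} \<omega> \<partial>test_model g)"
    by (subst nn_integral_indicator) (auto simp: sets_test_model)
  also have "\<dots> = ennreal (p g) * (\<integral>\<^sup>+x. indicator {\<omega>. \<not> fst \<omega> \<and> snd \<omega> \<in> A} (True, x) \<partial>normal_law (sqrt (sigma2 g + tau2 g)))
      + ennreal (1 - p g) * (\<integral>\<^sup>+x. indicator {\<omega>. \<not> fst \<omega> \<and> snd \<omega> \<in> A} (False, x) \<partial>normal_law (sqrt (sigma2 g)))"
    using g by (intro nn_integral_test_model) (auto simp: admissible_def)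
  also have "\<dots> = ennreal ((1 - p g) * N.prob A)"
    unfolding sec_False
    using g by (simp add: N.emeasure_eq_measure ennreal_mult admissible_def)
  finally show "T.prob {\<omega>. \<not> fst \<omega> \<and> snd \<omega> \<in> A} = (1 - p g) * N.prob A"
    using g by (simp add: T.emeasure_eq_measure admissible_def)
qed

lemma measure_normal_compl:
  assumes "0 < s"
  shows "measure (normal_law s) {x. x\<^sup>2 < w} = 1 - chi_tail (w / s\<^sup>2)"
proof -
  interpret N: prob_space "normal_law s" by (rule prob_space_normal_law[OF assms])
  have "N.prob {x. x\<^sup>2 < w} = 1 - N.prob {x. w \<le> x\<^sup>2}"
    by (subst N.prob_compl[symmetric]) (auto intro!: arg_cong[where f=N.prob])
  then show ?thesis using assms by (simp add: measure_normal_scale)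
qed

lemma odds_BFDR:
  assumes g: "admissible g"
  shows "odds (BFDR g c) = f_of g * chi_tail (c\<^sup>2) / chi_tail (c\<^sup>2 / (u_of g + 1))"
proof -
  interpret T: prob_space "test_model g" by (rule prob_space_test_model[OF g])
  have g': "0 < p g" "p g < 1" "0 < tau2 g" "0 < sigma2 g" using g by (auto simp: admissible_def)
  let ?A = "{x. c\<^sup>2 * sigma2 g \<le> x\<^sup>2}"
  define a where "a = (1 - p g) * chi_tail (c\<^sup>2)"
  define b where "b = p g * chi_tail (c\<^sup>2 / (u_of g + 1))"
  have u: "0 < u_of g" using g' by (simp add: u_of_def)
  have pos: "0 < a" "0 < b" using g' u by (auto simp: a_def b_def intro!: mult_pos_pos chi_tail_pos)
  have eq: "c\<^sup>2 \<le> x\<^sup>2 / sigma2 g \<longleftrightarrow> x \<in> ?A" for x using g' by (simp add: field_simps)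
  have m1: "T.prob {\<omega>. \<not> fst \<omega> \<and> snd \<omega> \<in> ?A} = a"
    using g' by (subst measure_test_model[OF g]) (auto simp: a_def measure_normal_scale)
  have "c\<^sup>2 * sigma2 g / (sigma2 g + tau2 g) = c\<^sup>2 / (u_of g + 1)"
    using g' by (simp add: u_of_def field_simps)
  then have m2: "T.prob {\<omega>. fst \<omega> \<and> snd \<omega> \<in> ?A} = b"
    using g' by (subst measure_test_model[OF g]) (auto simp: b_def measure_normal_scale)
  have "T.prob {\<omega>. snd \<omega> \<in> ?A} = T.prob ({\<omega>. \<not> fst \<omega> \<and> snd \<omega> \<in> ?A} \<union> {\<omega>. fst \<omega> \<and> snd \<omega> \<in> ?A})"
    by (rule arg_cong[where f=T.prob]) auto
  also have "\<dots> = a + b"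
    unfolding m1[symmetric] m2[symmetric]
  proof (rule T.finite_measure_Union)
    have A: "?A \<in> sets borel" by measurable
    show "{\<omega>. \<not> fst \<omega> \<and> snd \<omega> \<in> ?A} \<in> T.events" "{\<omega>. fst \<omega> \<and> snd \<omega> \<in> ?A} \<in> T.events"
      unfolding sets_test_model by (rule test_events[OF A])+
  qed auto
  finally have B: "BFDR g c = a / (a + b)"
    unfolding BFDR_def cond_prob_def eq using m1 by simp
  have "1 - a / (a + b) = b / (a + b)" using pos by (simp add: field_simps)
  then have "odds (BFDR g c) = a / b" unfolding odds_def B using pos by simp
  also have "\<dots> = f_of g * chi_tail (c\<^sup>2) / chi_tail (c\<^sup>2 / (u_of g + 1))"
    using g' by (simp add: a_def b_def f_of_def)
  finally show ?thesis .
qed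

section \<open>The Bayes risk of multiple testing rules\<close>

lemma prob_space_mt_model: "admissible g \<Longrightarrow> prob_space (mt_model m g)"
  unfolding mt_model_def by (intro prob_space_PiM prob_space_test_model)

lemma measurable_mt_model_component:
  assumes "i \<in> {1..m}"
  shows "(\<lambda>\<omega>. \<omega> i) \<in> measurable (mt_model m g) (count_space UNIV \<Otimes>\<^sub>M borel)"
proof -
  have "(\<lambda>\<omega>. \<omega> i) \<in> measurable (mt_model m g) (test_model g)"
    unfolding mt_model_def using assms by (rule measurable_component_singleton)
  then show ?thesis by (simp cong: measurable_cong_sets add: sets_test_model)
qed

lemma measurable_observed: "observed m \<in> measurable (mt_model m g) (\<Pi>\<^sub>M j\<in>{1..m}. borel)"
  unfolding observed_def[abs_def]
proof (rule measurable_restrict)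
  fix i assume "i \<in> {1..m}"
  from measurable_mt_model_component[OF this]
  show "(\<lambda>\<omega>. snd (\<omega> i)) \<in> borel_measurable (mt_model m g)" by (rule measurable_compose) simp
qed

lemma error_events_measurable:
  assumes \<phi>: "\<phi> \<in> mt_rules m" and i: "i \<in> {1..m}"
  shows "(\<lambda>\<omega>. \<phi> (observed m \<omega>) i) \<in> measurable (mt_model m g) (count_space UNIV)"
    and "(\<lambda>\<omega>. fst (\<omega> i)) \<in> measurable (mt_model m g) (count_space UNIV)"
    and "(\<lambda>\<omega>. snd (\<omega> i)) \<in> borel_measurable (mt_model m g)"
proof -
  have "(\<lambda>x. \<phi> x i) \<in> measurable (\<Pi>\<^sub>M j\<in>{1..m}. borel) (count_space UNIV)"
    using \<phi> i by (auto simp: mt_rules_def)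
  from measurable_compose[OF measurable_observed this]
  show "(\<lambda>\<omega>. \<phi> (observed m \<omega>) i) \<in> measurable (mt_model m g) (count_space UNIV)" .
  show "(\<lambda>\<omega>. fst (\<omega> i)) \<in> measurable (mt_model m g) (count_space UNIV)"
    using measurable_mt_model_component[OF i] by (rule measurable_compose) simp
  show "(\<lambda>\<omega>. snd (\<omega> i)) \<in> borel_measurable (mt_model m g)"
    using measurable_mt_model_component[OF i] by (rule measurable_compose) simp
qed

lemma (in prob_space) expectation_card:
  assumes fin: "finite I" and ev: "\<And>i. i \<in> I \<Longrightarrow> {\<omega> \<in> space M. P \<omega> i} \<in> events"
  shows "expectation (\<lambda>\<omega>. real (card {i \<in> I. P \<omega> i})) = (\<Sum>i\<in>I. prob {\<omega> \<in> space M. P \<omega> i})"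
proof -
  have "expectation (\<lambda>\<omega>. real (card {i \<in> I. P \<omega> i}))
      = expectation (\<lambda>\<omega>. \<Sum>i\<in>I. indicator {\<omega> \<in> space M. P \<omega> i} \<omega>)"
  proof (rule Bochner_Integration.integral_cong[OF refl])
    fix \<omega> assume "\<omega> \<in> space M"
    then have "(\<Sum>i\<in>I. indicator {\<omega> \<in> space M. P \<omega> i} \<omega>) = (\<Sum>i\<in>I. of_bool (P \<omega> i) :: real)"
      by (intro sum.cong) (auto simp: indicator_def)
    then show "real (card {i \<in> I. P \<omega> i}) = (\<Sum>i\<in>I. indicator {\<omega> \<in> space M. P \<omega> i} \<omega>)"
      using fin by (simp add: Int_def)
  qed
  also have "\<dots> = (\<Sum>i\<in>I. prob {\<omega> \<in> space M. P \<omega> i})"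
    using ev by (subst Bochner_Integration.integral_sum) (auto simp: emeasure_eq_measure)
  finally show ?thesis .
qed

lemma bayes_risk_sum:
  assumes g: "admissible g" and \<phi>: "\<phi> \<in> mt_rules m"
  shows "bayes_risk m g \<phi> = (\<Sum>i\<in>{1..m}.
     delta0 g * measure (mt_model m g) {\<omega>\<in>space (mt_model m g). \<not> fst (\<omega> i) \<and> \<phi> (observed m \<omega>) i} +
     deltaA g * measure (mt_model m g) {\<omega>\<in>space (mt_model m g). fst (\<omega> i) \<and> \<not> \<phi> (observed m \<omega>) i})"
proof -
  interpret prob_space "mt_model m g" by (rule prob_space_mt_model[OF g])
  note [measurable] = error_events_measurable[OF \<phi>]
  show ?thesis
    unfolding bayes_risk_def false_rejections_def false_acceptances_def
    by (subst (1 2) expectation_card) (auto simp: sum_distrib_left sum.distrib)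
qed

lemma fixed_threshold_rule_in_mt_rules: "fixed_threshold_rule g c \<in> mt_rules m"
  unfolding mt_rules_def fixed_threshold_rule_def by measurable

lemma measure_mt_model_component:
  assumes g: "admissible g" and i: "i \<in> {1..m}" and E: "E \<in> sets (count_space UNIV \<Otimes>\<^sub>M borel)"
  shows "measure (mt_model m g) {\<omega>\<in>space (mt_model m g). \<omega> i \<in> E} = measure (test_model g) E"
proof -
  have "test_model g = distr (mt_model m g) (test_model g) (\<lambda>\<omega>. \<omega> i)"
    unfolding mt_model_def using i prob_space_test_model[OF g] by (subst distr_PiM_component) auto
  then have "measure (test_model g) E = measure (distr (mt_model m g) (test_model g) (\<lambda>\<omega>. \<omega> i)) E"
    by simp
  also have "\<dots> = measure (mt_model m g) ((\<lambda>\<omega>. \<omega> i) -` E \<inter> space (mt_model m g))"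
    using E i by (intro measure_distr) (auto simp: sets_test_model mt_model_def)
  finally show ?thesis by (simp add: vimage_def Int_def conj_commute)
qed

lemma bayes_risk_fixed_threshold:
  assumes g: "admissible g"
  shows "bayes_risk m g (fixed_threshold_rule g c) = real m * p g * deltaA g *
    (f_of g * delta_of g * chi_tail (c\<^sup>2) + (1 - chi_tail (c\<^sup>2 / (u_of g + 1))))"
proof -
  have g': "0 < p g" "p g < 1" "0 < tau2 g" "0 < sigma2 g" "0 < deltaA g" using g by (auto simp: admissible_def)
  have eq: "c\<^sup>2 \<le> x\<^sup>2 / sigma2 g \<longleftrightarrow> x \<in> {x. c\<^sup>2 * sigma2 g \<le> x\<^sup>2}"
    "\<not> c\<^sup>2 \<le> x\<^sup>2 / sigma2 g \<longleftrightarrow> x \<in> {x. x\<^sup>2 < c\<^sup>2 * sigma2 g}" for x using g' by (auto simp: field_simps)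
  have scale: "c\<^sup>2 * sigma2 g / (sigma2 g + tau2 g) = c\<^sup>2 / (u_of g + 1)"
    using g' by (simp add: u_of_def field_simps)
  let ?M = "mt_model m g"
  have R: "{x. c\<^sup>2 * sigma2 g \<le> x\<^sup>2} \<in> sets borel" by measurable
  have A: "{x. x\<^sup>2 < c\<^sup>2 * sigma2 g} \<in> sets borel" by measurable
  have risk_i: "delta0 g * measure ?M {\<omega>\<in>space ?M. \<not> fst (\<omega> i) \<and> fixed_threshold_rule g c (observed m \<omega>) i} +
     deltaA g * measure ?M {\<omega>\<in>space ?M. fst (\<omega> i) \<and> \<not> fixed_threshold_rule g c (observed m \<omega>) i}
     = p g * deltaA g * (f_of g * delta_of g * chi_tail (c\<^sup>2) + (1 - chi_tail (c\<^sup>2 / (u_of g + 1))))"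
    if i: "i \<in> {1..m}" for i
  proof -
    have e1: "{\<omega>\<in>space ?M. \<not> fst (\<omega> i) \<and> fixed_threshold_rule g c (observed m \<omega>) i}
        = {\<omega>\<in>space ?M. \<omega> i \<in> {z. \<not> fst z \<and> snd z \<in> {x. c\<^sup>2 * sigma2 g \<le> x\<^sup>2}}}"
      using i by (auto simp: fixed_threshold_rule_def observed_def eq)
    have m1: "measure ?M \<dots> = (1 - p g) * chi_tail (c\<^sup>2)"
      unfolding measure_mt_model_component[OF g i test_events(2)[OF R]] measure_test_model(2)[OF g R]
      using g' by (simp add: measure_normal_scale)
    have e2: "{\<omega>\<in>space ?M. fst (\<omega> i) \<and> \<not> fixed_threshold_rule g c (observed m \<omega>) i}
        = {\<omega>\<in>space ?M. \<omega> i \<in> {z. fst z \<and> snd z \<in> {x. x\<^sup>2 < c\<^sup>2 * sigma2 g}}}"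
      using i by (auto simp: fixed_threshold_rule_def observed_def eq)
    have m2: "measure ?M \<dots> = p g * (1 - chi_tail (c\<^sup>2 / (u_of g + 1)))"
      unfolding measure_mt_model_component[OF g i test_events(1)[OF A]] measure_test_model(1)[OF g A]
      using g' by (simp add: measure_normal_compl scale)
    show ?thesis
      unfolding e1 m1 e2 m2 using g' by (simp add: f_of_def delta_of_def field_simps)
  qed
  show ?thesis
    unfolding bayes_risk_sum[OF g fixed_threshold_rule_in_mt_rules]
    by (subst sum.cong[OF refl risk_i]) auto
qed

section \<open>A lower bound for the risk of every rule\<close>

text \<open>
  The region is \<open>x\<^sup>2 / \<sigma>\<^sup>2 < (1 + 1/u) ln v\<close>, because \<open>(\<sigma>\<^sup>2 + \<tau>\<^sup>2) / u = (1 + 1/u) \<sigma>\<^sup>2\<close>. It is slightly smaller than the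
  acceptance region of the Bayes oracle: the term \<open>ln (1 + 1/u)\<close> is dropped. The null hypothesis therefore has the
  larger weighted density on it.
\<close>

lemma weighted_density_le:
  assumes g: "admissible g" and v: "1 \<le> v_of g"
    and x: "x\<^sup>2 < ln (v_of g) / u_of g * (sigma2 g + tau2 g)"
  shows "deltaA g * p g * normal_density 0 (sqrt (sigma2 g + tau2 g)) x
    \<le> delta0 g * (1 - p g) * normal_density 0 (sqrt (sigma2 g)) x"
proof -
  define s where "s = sigma2 g"
  define r where "r = sigma2 g + tau2 g"
  define h where "h = f_of g * delta_of g"
  have g': "0 < p g" "p g < 1" "0 < s" "s < r" "0 < deltaA g" "0 < delta0 g"
    using g by (auto simp: admissible_def s_def r_def)
  have h: "0 < h" using g' by (simp add: h_def f_of_def delta_of_def)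
  have u: "u_of g = (r - s) / s" "0 < u_of g" using g' by (auto simp: u_of_def s_def r_def)
  have v2: "v_of g = u_of g * h\<^sup>2" by (simp add: v_of_def h_def power_mult_distrib)
  have "x\<^sup>2 * u_of g < ln (v_of g) * r"
    using x u(2) by (simp add: r_def field_simps)
  then have "x\<^sup>2 * u_of g / r < ln (v_of g)"
    using g' by (simp add: field_simps)
  moreover have "x\<^sup>2 / (2 * s) = x\<^sup>2 / (2 * r) + x\<^sup>2 * u_of g / r / 2"
    using g' by (simp add: u field_simps)
  ultimately have "- x\<^sup>2 / (2 * r) - ln (v_of g) / 2 \<le> - x\<^sup>2 / (2 * s)" by simp
  then have "exp (- x\<^sup>2 / (2 * r)) / exp (ln (v_of g) / 2) \<le> exp (- x\<^sup>2 / (2 * s))"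
    by (simp add: exp_diff[symmetric])
  moreover have "exp (ln (v_of g) / 2) = sqrt (v_of g)"
    using v by (simp add: ln_sqrt[symmetric])
  ultimately have "exp (- x\<^sup>2 / (2 * r)) \<le> sqrt (v_of g) * exp (- x\<^sup>2 / (2 * s))"
    using v by (simp add: field_simps)
  also have "sqrt (v_of g) = sqrt (u_of g) * h"
    using h by (simp add: v2 real_sqrt_mult)
  also have "sqrt (u_of g) * h * exp (- x\<^sup>2 / (2 * s)) \<le> sqrt (r / s) * h * exp (- x\<^sup>2 / (2 * s))"
    using h g' by (intro mult_right_mono) (auto simp: u divide_right_mono)
  finally have "exp (- x\<^sup>2 / (2 * r)) / sqrt r \<le> h * (exp (- x\<^sup>2 / (2 * s)) / sqrt s)"
    using g' by (simp add: real_sqrt_divide field_simps)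
  then have "exp (- x\<^sup>2 / (2 * r)) / sqrt r / sqrt (2 * pi) \<le> h * (exp (- x\<^sup>2 / (2 * s)) / sqrt s) / sqrt (2 * pi)"
    by (rule divide_right_mono) simp
  then have "normal_density 0 (sqrt r) x \<le> h * normal_density 0 (sqrt s) x"
    using g' by (simp add: normal_density_def real_sqrt_mult mult_ac)
  then have "deltaA g * p g * normal_density 0 (sqrt r) x \<le> deltaA g * p g * (h * normal_density 0 (sqrt s) x)"
    using g' by (intro mult_left_mono) auto
  also have "\<dots> = delta0 g * (1 - p g) * normal_density 0 (sqrt s) x"
    using g' by (simp add: h_def f_of_def delta_of_def)
  finally show ?thesis by (simp add: s_def r_def)
qed

lemma weighted_law_le:
  assumes g: "admissible g" and v: "1 \<le> v_of g"
    and [measurable]: "A \<in> sets borel"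
    and sub: "A \<subseteq> {x. x\<^sup>2 < ln (v_of g) / u_of g * (sigma2 g + tau2 g)}"
  shows "deltaA g * measure (test_model g) {\<omega>. fst \<omega> \<and> snd \<omega> \<in> A}
    \<le> delta0 g * measure (test_model g) {\<omega>. \<not> fst \<omega> \<and> snd \<omega> \<in> A}"
proof -
  have pos: "0 < sqrt (sigma2 g + tau2 g)" "0 < sqrt (sigma2 g)" using g by (auto simp: admissible_def)
  have int: "integrable lborel (\<lambda>x. c * (indicator A x * normal_density 0 s x))"
    if "0 < s" for c s
    by (rule integrable_mult_right)
      (rule Bochner_Integration.integrable_bound[OF integrable_normal_density[OF that, of 0]], auto simp: indicator_def)
  have "(LINT x|lborel. (deltaA g * p g) * (indicator A x * normal_density 0 (sqrt (sigma2 g + tau2 g)) x))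
    \<le> (LINT x|lborel. (delta0 g * (1 - p g)) * (indicator A x * normal_density 0 (sqrt (sigma2 g)) x))"
    using weighted_density_le[OF g v] sub
    by (intro integral_mono int pos) (auto simp: indicator_def)
  then show ?thesis
    using pos by (simp add: measure_test_model[OF g] measure_normal_integral mult.assoc)
qed

text \<open>
  A decision may depend on all observations. By Fubini, the observations of the other tests can be fixed; the
  rejection region of test \<open>i\<close> is then a Borel set of values of \<open>X\<^sub>i\<close>, and the comparison for a single test applies.
\<close>

lemma rejection_cost_le:
  assumes g: "admissible g" and v: "1 \<le> v_of g" and \<phi>: "\<phi> \<in> mt_rules m" and i: "i \<in> {1..m}"
  defines "S \<equiv> {x. x\<^sup>2 < ln (v_of g) / u_of g * (sigma2 g + tau2 g)}"
  shows "deltaA g * measure (mt_model m g)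
      {\<omega>\<in>space (mt_model m g). fst (\<omega> i) \<and> snd (\<omega> i) \<in> S \<and> \<phi> (observed m \<omega>) i}
    \<le> delta0 g * measure (mt_model m g)
      {\<omega>\<in>space (mt_model m g). \<not> fst (\<omega> i) \<and> snd (\<omega> i) \<in> S \<and> \<phi> (observed m \<omega>) i}"
proof -
  interpret T: prob_space "test_model g" by (rule prob_space_test_model[OF g])
  interpret product_sigma_finite "\<lambda>_::nat. test_model g" by standard
  interpret M: prob_space "mt_model m g" by (rule prob_space_mt_model[OF g])
  let ?M = "mt_model m g"
  let ?J = "{1..m} - {i}"
  have J: "insert i ?J = {1..m}" using i by auto
  have pos: "0 < deltaA g" "0 < delta0 g" using g by (auto simp: admissible_def)
  note meas [measurable] = error_events_measurable[OF \<phi> i, of g]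
  have S [measurable]: "S \<in> sets borel" unfolding S_def by measurable
  have fubini: "ennreal (d * measure ?M {\<omega>\<in>space ?M. P (fst (\<omega> i)) \<and> snd (\<omega> i) \<in> S \<and> \<phi> (observed m \<omega>) i})
    = (\<integral>\<^sup>+x. ennreal (d * measure (test_model g)
         {y. P (fst y) \<and> snd y \<in> {z\<in>S. \<phi> (observed m (x(i := (True, z)))) i}}) \<partial>(\<Pi>\<^sub>M j\<in>?J. test_model g))"
    if d: "0 < d" for d :: real and P :: "bool \<Rightarrow> bool"
  proof -
    let ?E = "{\<omega>\<in>space ?M. P (fst (\<omega> i)) \<and> snd (\<omega> i) \<in> S \<and> \<phi> (observed m \<omega>) i}"
    have E: "?E \<in> sets ?M" by measurable
    have "ennreal (d * M.prob ?E) = ennreal d * emeasure ?M ?E"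
      using d by (simp add: M.emeasure_eq_measure ennreal_mult)
    also have "\<dots> = (\<integral>\<^sup>+\<omega>. ennreal d * indicator ?E \<omega> \<partial>?M)"
      using E by (simp add: nn_integral_cmult_indicator)
    also have "\<dots> = (\<integral>\<^sup>+\<omega>. ennreal d * indicator ?E \<omega> \<partial>(\<Pi>\<^sub>M j\<in>insert i ?J. test_model g))"
      unfolding J by (simp add: mt_model_def)
    also have "\<dots> = (\<integral>\<^sup>+x. \<integral>\<^sup>+y. ennreal d * indicator ?E (x(i := y)) \<partial>test_model g \<partial>(\<Pi>\<^sub>M j\<in>?J. test_model g))"
    proof (rule product_nn_integral_insert)
      show "(\<lambda>\<omega>. ennreal d * indicator ?E \<omega>) \<in> borel_measurable (\<Pi>\<^sub>M j\<in>insert i ?J. test_model g)"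
        unfolding J using E by (simp add: mt_model_def)
    qed auto
    also have "\<dots> = (\<integral>\<^sup>+x. ennreal (d * measure (test_model g)
         {y. P (fst y) \<and> snd y \<in> {z\<in>S. \<phi> (observed m (x(i := (True, z)))) i}}) \<partial>(\<Pi>\<^sub>M j\<in>?J. test_model g))"
    proof (rule nn_integral_cong)
      fix x assume x: "x \<in> space (\<Pi>\<^sub>M j\<in>?J. test_model g)"
      let ?F = "{y. P (fst y) \<and> snd y \<in> {z\<in>S. \<phi> (observed m (x(i := (True, z)))) i}}"
      have upd: "(\<lambda>y. x(i := y)) \<in> measurable (test_model g) ?M"
        using measurable_component_update[OF x, of i] unfolding J by (simp add: mt_model_def)
      \<comment> \<open>The rule does not see the first component, so setting it to \<^const>\<open>True\<close> is harmless.\<close>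
      have obs: "observed m (x(i := y)) = observed m (x(i := (True, snd y)))" for y
        by (auto simp: observed_def restrict_def fun_eq_iff)
      have mem: "x(i := y) \<in> ?E \<longleftrightarrow> y \<in> ?F" for y
        using measurable_space[OF upd, of y] obs[of y] by auto
      have "?F = (\<lambda>y. x(i := y)) -` ?E \<inter> space (test_model g)" using mem by auto
      then have F: "?F \<in> T.events" using measurable_sets[OF upd E] by simp
      have "(\<integral>\<^sup>+y. ennreal d * indicator ?E (x(i := y)) \<partial>test_model g) = (\<integral>\<^sup>+y. ennreal d * indicator ?F y \<partial>test_model g)"
        by (intro nn_integral_cong) (use mem in \<open>auto simp: indicator_def\<close>)
      also have "\<dots> = ennreal (d * T.prob ?F)"
        using d F by (simp add: nn_integral_cmult_indicator T.emeasure_eq_measure ennreal_mult)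
      finally show "(\<integral>\<^sup>+y. ennreal d * indicator ?E (x(i := y)) \<partial>test_model g) = ennreal (d * T.prob ?F)" .
    qed
    finally show ?thesis .
  qed
  have "ennreal (deltaA g * M.prob {\<omega>\<in>space ?M. (\<lambda>b. b) (fst (\<omega> i)) \<and> snd (\<omega> i) \<in> S \<and> \<phi> (observed m \<omega>) i})
     \<le> ennreal (delta0 g * M.prob {\<omega>\<in>space ?M. \<not> fst (\<omega> i) \<and> snd (\<omega> i) \<in> S \<and> \<phi> (observed m \<omega>) i})"
    unfolding fubini[OF pos(1), of "\<lambda>b. b"] fubini[OF pos(2), of Not]
  proof (intro nn_integral_mono ennreal_leI weighted_law_le[OF g v])
    fix x assume x: "x \<in> space (\<Pi>\<^sub>M j\<in>?J. test_model g)"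
    have "(\<lambda>y. x(i := y)) \<in> measurable (test_model g) ?M"
      using measurable_component_update[OF x, of i] unfolding J by (simp add: mt_model_def)
    then have [measurable]: "(\<lambda>z. x(i := (True, z))) \<in> measurable borel ?M"
      by (rule measurable_compose[rotated]) (simp add: measurable_cong_sets[OF refl sets_test_model])
    have [measurable]: "(\<lambda>z. \<phi> (observed m (x(i := (True, z)))) i) \<in> measurable borel (count_space UNIV)"
      by (rule measurable_compose[OF _ meas(1)]) measurable
    show "{z\<in>S. \<phi> (observed m (x(i := (True, z)))) i} \<in> sets borel" by measurable
  qed (auto simp: S_def)
  then show ?thesis
    using pos by (simp add: ennreal_le_iff measure_nonneg)
qed

text \<open>
  Let \<open>S\<close> be the region of the preceding lemma. Rejections with \<open>X\<^sub>i\<close> in \<open>S\<close> cost at least what accepting instead would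
  cost. Hence each test costs at least \<open>deltaA\<close> times the probability that the alternative holds and \<open>X\<^sub>i\<close> lies in \<open>S\<close>.
\<close>

lemma bayes_risk_lower_bound:
  assumes g: "admissible g" and v: "1 \<le> v_of g" and \<phi>: "\<phi> \<in> mt_rules m"
  shows "real m * p g * deltaA g * (1 - chi_tail (ln (v_of g) / u_of g)) \<le> bayes_risk m g \<phi>"
proof -
  interpret M: prob_space "mt_model m g" by (rule prob_space_mt_model[OF g])
  let ?M = "mt_model m g"
  define S where "S = {x. x\<^sup>2 < ln (v_of g) / u_of g * (sigma2 g + tau2 g)}"
  have S [measurable]: "S \<in> sets borel" unfolding S_def by measurable
  have g': "0 < p g" "0 < deltaA g" "0 < delta0 g" "0 < sigma2 g" "0 < tau2 g" using g by (auto simp: admissible_def)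
  have "p g * deltaA g * (1 - chi_tail (ln (v_of g) / u_of g)) \<le>
     delta0 g * M.prob {\<omega>\<in>space ?M. \<not> fst (\<omega> i) \<and> \<phi> (observed m \<omega>) i} +
     deltaA g * M.prob {\<omega>\<in>space ?M. fst (\<omega> i) \<and> \<not> \<phi> (observed m \<omega>) i}"
    if i: "i \<in> {1..m}" for i
  proof -
    note [measurable] = error_events_measurable[OF \<phi> i, of g]
    let ?R = "\<lambda>\<omega>. snd (\<omega> i) \<in> S \<and> \<phi> (observed m \<omega>) i"
    let ?A = "\<lambda>\<omega>. snd (\<omega> i) \<in> S \<and> \<not> \<phi> (observed m \<omega>) i"
    have "p g * (1 - chi_tail (ln (v_of g) / u_of g)) = measure (test_model g) {y. fst y \<and> snd y \<in> S}"
      unfolding measure_test_model(1)[OF g S] unfolding S_def using g' by (simp add: measure_normal_compl)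
    also have "\<dots> = M.prob {\<omega>\<in>space ?M. \<omega> i \<in> {y. fst y \<and> snd y \<in> S}}"
      by (rule measure_mt_model_component[OF g i test_events(1)[OF S], symmetric])
    also have "\<dots> = M.prob ({\<omega>\<in>space ?M. fst (\<omega> i) \<and> ?R \<omega>} \<union> {\<omega>\<in>space ?M. fst (\<omega> i) \<and> ?A \<omega>})"
      by (rule arg_cong[where f=M.prob]) auto
    also have "\<dots> = M.prob {\<omega>\<in>space ?M. fst (\<omega> i) \<and> ?R \<omega>} + M.prob {\<omega>\<in>space ?M. fst (\<omega> i) \<and> ?A \<omega>}"
      by (rule M.finite_measure_Union) auto
    finally have split: "p g * (1 - chi_tail (ln (v_of g) / u_of g))
      = M.prob {\<omega>\<in>space ?M. fst (\<omega> i) \<and> ?R \<omega>} + M.prob {\<omega>\<in>space ?M. fst (\<omega> i) \<and> ?A \<omega>}" .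
    have "p g * deltaA g * (1 - chi_tail (ln (v_of g) / u_of g)) = deltaA g * (p g * (1 - chi_tail (ln (v_of g) / u_of g)))"
      by simp
    also have "\<dots>
      = deltaA g * M.prob {\<omega>\<in>space ?M. fst (\<omega> i) \<and> ?R \<omega>} + deltaA g * M.prob {\<omega>\<in>space ?M. fst (\<omega> i) \<and> ?A \<omega>}"
      unfolding split by (rule distrib_left)
    also have "\<dots> \<le> delta0 g * M.prob {\<omega>\<in>space ?M. \<not> fst (\<omega> i) \<and> ?R \<omega>} + deltaA g * M.prob {\<omega>\<in>space ?M. fst (\<omega> i) \<and> ?A \<omega>}"
      using rejection_cost_le[OF g v \<phi> i] by (simp add: S_def)
    also have "\<dots> \<le> delta0 g * M.prob {\<omega>\<in>space ?M. \<not> fst (\<omega> i) \<and> \<phi> (observed m \<omega>) i} +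
     deltaA g * M.prob {\<omega>\<in>space ?M. fst (\<omega> i) \<and> \<not> \<phi> (observed m \<omega>) i}"
      using g' by (intro add_mono mult_left_mono M.finite_measure_mono) auto
    finally show ?thesis .
  qed
  then have "(\<Sum>i\<in>{1..m}. p g * deltaA g * (1 - chi_tail (ln (v_of g) / u_of g))) \<le> bayes_risk m g \<phi>"
    unfolding bayes_risk_sum[OF g \<phi>] by (rule sum_mono)
  then show ?thesis by (simp add: mult.assoc)
qed

lemma R_opt_bounds:
  assumes g: "admissible g" and v: "1 \<le> v_of g"
  shows "real m * p g * deltaA g * (1 - chi_tail (ln (v_of g) / u_of g)) \<le> R_opt m g"
    and "\<phi> \<in> mt_rules m \<Longrightarrow> R_opt m g \<le> bayes_risk m g \<phi>"
proof -
  show "real m * p g * deltaA g * (1 - chi_tail (ln (v_of g) / u_of g)) \<le> R_opt m g"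
    unfolding R_opt_def
    by (rule cINF_greatest) (use fixed_threshold_rule_in_mt_rules bayes_risk_lower_bound[OF g v] in blast)+
  have "bdd_below (bayes_risk m g ` mt_rules m)"
    using bayes_risk_lower_bound[OF g v] by (auto simp: bdd_below_def)
  then show "R_opt m g \<le> bayes_risk m g \<phi>" if "\<phi> \<in> mt_rules m"
    unfolding R_opt_def using that by (rule cINF_lower)
qed

section \<open>Asymptotic optimality\<close>

text \<open>
  After division by \<open>m p deltaA\<close>, the risk of the rule is \<open>r1 + 1 - chi_tail w\<close> and the optimal risk is at least
  \<open>1 - chi_tail l\<close>, where \<open>w\<close> and \<open>l\<close> both converge to \<open>C\<close> and the type I contribution \<open>r1\<close> tends to 0.
\<close>

lemma ABOS_fixed_threshold:
  fixes \<gamma> :: "nat \<Rightarrow> params" and C :: real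
  assumes adm: "\<forall>t\<ge>1. admissible (\<gamma> t)"
    and u: "filterlim (\<lambda>t. u_of (\<gamma> t)) at_top sequentially"
    and v: "filterlim (\<lambda>t. v_of (\<gamma> t)) at_top sequentially"
    and C: "0 < C" "(\<lambda>t. ln (v_of (\<gamma> t)) / u_of (\<gamma> t)) \<longlonglongrightarrow> C"
    and m: "\<forall>t\<ge>1. m t \<ge> 1"
    and K: "0 < K" "(\<lambda>t. odds (\<alpha> t) * (delta_of (\<gamma> t) * sqrt (u_of (\<gamma> t)))) \<longlonglongrightarrow> K"
    and bfdr: "\<forall>\<^sub>F t in sequentially. BFDR (\<gamma> t) (c t) = \<alpha> t"
  shows "ABOS m \<gamma> (\<lambda>t. fixed_threshold_rule (\<gamma> t) (c t))"
proof -
  define w where "w t = (c t)\<^sup>2 / (u_of (\<gamma> t) + 1)" for t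
  define l where "l t = ln (v_of (\<gamma> t)) / u_of (\<gamma> t)" for t
  define r1 where "r1 t = f_of (\<gamma> t) * delta_of (\<gamma> t) * chi_tail ((c t)\<^sup>2)" for t
  define k where "k t = odds (\<alpha> t) * (delta_of (\<gamma> t) * sqrt (u_of (\<gamma> t)))" for t
  have kK: "k \<longlonglongrightarrow> K" using K(2) by (simp add: k_def[abs_def])
  have ev: "\<forall>\<^sub>F t in sequentially. admissible (\<gamma> t) \<and> 0 < u_of (\<gamma> t) \<and> 1 \<le> v_of (\<gamma> t) \<and> 1 \<le> m t"
  proof -
    have "\<forall>\<^sub>F t in sequentially. 1 \<le> v_of (\<gamma> t)" using v by (auto simp: filterlim_at_top)
    then show ?thesis using eventually_ge_at_top[of 1]
      by eventually_elim (use adm m in \<open>auto simp: u_of_def admissible_def\<close>)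
  qed
  have k_eq: "\<forall>\<^sub>F t in sequentially. k t = sqrt (v_of (\<gamma> t)) * chi_tail ((c t)\<^sup>2) / chi_tail (w t)
      \<and> r1 t = k t * chi_tail (w t) / sqrt (u_of (\<gamma> t))"
    using ev bfdr
  proof eventually_elim
    case (elim t)
    then have g: "admissible (\<gamma> t)" and u0: "0 < u_of (\<gamma> t)" by auto
    have fd: "0 < f_of (\<gamma> t)" "0 < delta_of (\<gamma> t)"
      using g by (auto simp: admissible_def f_of_def delta_of_def)
    have w0: "0 < chi_tail (w t)" using u0 by (auto simp: w_def intro!: chi_tail_pos)
    have o: "odds (\<alpha> t) = f_of (\<gamma> t) * chi_tail ((c t)\<^sup>2) / chi_tail (w t)"
      using odds_BFDR[OF g, of "c t"] elim by (simp add: w_def)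
    have "sqrt (v_of (\<gamma> t)) = sqrt (u_of (\<gamma> t)) * f_of (\<gamma> t) * delta_of (\<gamma> t)"
      using fd by (simp add: v_of_def real_sqrt_mult)
    then show ?case using o u0 w0 by (simp add: k_def r1_def mult_ac)
  qed
  have wC: "w \<longlonglongrightarrow> C"
    unfolding w_def
  proof (rule threshold_limit[OF u v C(2) _ K(1)])
    show "(\<lambda>t. sqrt (v_of (\<gamma> t)) * chi_tail ((c t)\<^sup>2) / chi_tail ((c t)\<^sup>2 / (u_of (\<gamma> t) + 1))) \<longlonglongrightarrow> K"
      by (rule Lim_transform_eventually[OF kK]) (use k_eq in eventually_elim, auto simp: w_def)
  qed
  have lC: "l \<longlonglongrightarrow> C" using C(2) by (simp add: l_def[abs_def])
  have t0: "(\<lambda>t. k t * chi_tail (w t) / sqrt (u_of (\<gamma> t))) \<longlonglongrightarrow> 0"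
    by (rule tendsto_divide_0[OF tendsto_mult[OF kK chi_tail_tendsto[OF wC C(1)]]])
      (rule filterlim_at_top_imp_at_infinity[OF filterlim_compose[OF sqrt_at_top u]])
  have r1: "r1 \<longlonglongrightarrow> 0"
    by (rule Lim_transform_eventually[OF t0]) (use k_eq in eventually_elim, auto)
  have C1: "chi_tail C < 1" by (rule chi_tail_less_1[OF C(1)])
  have "(\<lambda>t. (r1 t + (1 - chi_tail (w t))) / (1 - chi_tail (l t))) \<longlonglongrightarrow> (0 + (1 - chi_tail C)) / (1 - chi_tail C)"
    using C1 by (intro tendsto_intros r1 chi_tail_tendsto wC lC C) auto
  then have upper: "(\<lambda>t. (r1 t + (1 - chi_tail (w t))) / (1 - chi_tail (l t))) \<longlonglongrightarrow> 1"
    using C1 by simp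
  have "\<forall>\<^sub>F t in sequentially. chi_tail (l t) < 1"
    by (rule order_tendstoD(2)[OF chi_tail_tendsto[OF lC C(1)] C1])
  with ev have bd: "\<forall>\<^sub>F t in sequentially.
      1 \<le> bayes_risk (m t) (\<gamma> t) (fixed_threshold_rule (\<gamma> t) (c t)) / R_opt (m t) (\<gamma> t) \<and>
      bayes_risk (m t) (\<gamma> t) (fixed_threshold_rule (\<gamma> t) (c t)) / R_opt (m t) (\<gamma> t)
        \<le> (r1 t + (1 - chi_tail (w t))) / (1 - chi_tail (l t))"
  proof eventually_elim
    case (elim t)
    then have g: "admissible (\<gamma> t)" and v1: "1 \<le> v_of (\<gamma> t)" by auto
    define R where "R = bayes_risk (m t) (\<gamma> t) (fixed_threshold_rule (\<gamma> t) (c t))"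
    define a where "a = real (m t) * p (\<gamma> t) * deltaA (\<gamma> t)"
    have a: "0 < a" using g elim by (auto simp: a_def admissible_def)
    have R: "R = a * (r1 t + (1 - chi_tail (w t)))"
      by (simp add: R_def a_def bayes_risk_fixed_threshold[OF g] r1_def w_def)
    have lo: "a * (1 - chi_tail (l t)) \<le> R_opt (m t) (\<gamma> t)"
      using R_opt_bounds(1)[OF g v1, of "m t"] by (simp add: a_def l_def)
    have hi: "R_opt (m t) (\<gamma> t) \<le> R"
      unfolding R_def by (rule R_opt_bounds(2)[OF g v1 fixed_threshold_rule_in_mt_rules])
    have p1: "0 < a * (1 - chi_tail (l t))" using a elim by simp
    then have "0 < R_opt (m t) (\<gamma> t)" using lo by linarith
    moreover have "R / R_opt (m t) (\<gamma> t) \<le> R / (a * (1 - chi_tail (l t)))"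
      using p1 lo hi by (intro divide_left_mono) auto
    ultimately show ?case
      using hi a by (simp add: R_def[symmetric]) (simp add: R)
  qed
  show ?thesis
    unfolding ABOS_def
    by (rule tendsto_sandwich[OF _ _ tendsto_const upper]) (use bd in eventually_elim, auto)+
qed

section \<open>The level in terms of the number of tests\<close>

lemma tendsto_affine_ratio:
  fixes q :: "nat \<Rightarrow> real" and Q :: ereal
  assumes "0 < \<beta>" "0 \<le> Q" and q: "((\<lambda>n. ereal (q n)) \<longlongrightarrow> Q) sequentially"
  shows "\<exists>L>0. (\<lambda>n. (1 + q n) / (\<beta> + q n)) \<longlonglongrightarrow> L"
proof (cases Q)
  case (real r)
  then have "q \<longlonglongrightarrow> r" "0 \<le> r" using q assms(2) by (auto simp: tendsto_ereal)
  then show ?thesis using assms(1)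
    by (intro exI[of _ "(1 + r) / (\<beta> + r)"]) (auto intro!: tendsto_intros)
next
  case PInf
  then have "filterlim q at_top sequentially"
    using q by (simp add: tendsto_PInfty_eq_at_top)
  moreover have "((\<lambda>x. (1 + x) / (\<beta> + x)) \<longlongrightarrow> 1) at_top" by real_asymp
  ultimately have "(\<lambda>n. (1 + q n) / (\<beta> + q n)) \<longlonglongrightarrow> 1" by (rule filterlim_compose[rotated])
  then show ?thesis by (intro exI[of _ 1]) auto
next
  case MInf
  then show ?thesis using assms by simp
qed

text \<open>
  Since \<open>ln v = ln u + 2 ln f + 2 ln \<delta>\<close>, where \<open>ln u = o(u)\<close> and \<open>ln f = \<beta> ln m + O(1)\<close>, the quotient
  \<open>(\<beta> ln m + ln \<delta>) / u\<close> converges to \<open>C / 2\<close>. The limit of \<open>ln \<delta> / ln m\<close> compares \<open>\<beta> ln m + ln \<delta>\<close> with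
  \<open>ln m + ln \<delta>\<close>. So \<open>ln (m \<delta>)\<close> is asymptotically a positive multiple of \<open>u\<close>.
\<close>

lemma ln_m_delta_proportional:
  fixes \<gamma> :: "nat \<Rightarrow> params"
  assumes adm: "\<forall>t\<ge>1. admissible (\<gamma> t)"
    and p0: "(\<lambda>t. p (\<gamma> t)) \<longlonglongrightarrow> 0"
    and u: "filterlim (\<lambda>t. u_of (\<gamma> t)) at_top sequentially"
    and C: "0 < C" "(\<lambda>t. ln (v_of (\<gamma> t)) / u_of (\<gamma> t)) \<longlonglongrightarrow> C"
    and beta: "0 < \<beta>" and p_beta: "asymp_proportional (\<lambda>m. p (\<gamma> m)) (\<lambda>m. real m powr (- \<beta>))"
    and Cd: "0 \<le> C\<^sub>\<delta>" "((\<lambda>m. ereal (ln (delta_of (\<gamma> m)) / ln (real m))) \<longlongrightarrow> C\<^sub>\<delta>) sequentially"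
  shows "\<exists>L>0. (\<lambda>m. ln (real m * delta_of (\<gamma> m)) / u_of (\<gamma> m)) \<longlonglongrightarrow> L"
proof -
  obtain K where K: "0 < K" "(\<lambda>m. p (\<gamma> m) / real m powr (- \<beta>)) \<longlonglongrightarrow> K"
    using p_beta by (auto simp: asymp_proportional_def)
  obtain L where L: "0 < L"
    "(\<lambda>m. (1 + ln (delta_of (\<gamma> m)) / ln (real m)) / (\<beta> + ln (delta_of (\<gamma> m)) / ln (real m))) \<longlonglongrightarrow> L"
    using tendsto_affine_ratio[OF beta Cd] by blast
  let ?b = "\<lambda>m. \<beta> * ln (real m) + ln (delta_of (\<gamma> m))"
  define w where "w m = 1 / 2 * (ln (v_of (\<gamma> m)) / u_of (\<gamma> m) - ln (u_of (\<gamma> m)) / u_of (\<gamma> m)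
    - 2 * ((ln (1 - p (\<gamma> m)) - ln (p (\<gamma> m) / real m powr (- \<beta>))) / u_of (\<gamma> m)))" for m
  have inf: "filterlim (\<lambda>t. u_of (\<gamma> t)) at_infinity sequentially"
    by (rule filterlim_at_top_imp_at_infinity[OF u])
  have "((\<lambda>x::real. ln x / x) \<longlongrightarrow> 0) at_top" by real_asymp
  then have 1: "(\<lambda>m. ln (u_of (\<gamma> m)) / u_of (\<gamma> m)) \<longlonglongrightarrow> 0" by (rule filterlim_compose[OF _ u])
  have "(\<lambda>m. ln (1 - p (\<gamma> m)) - ln (p (\<gamma> m) / real m powr (- \<beta>))) \<longlonglongrightarrow> ln (1 - 0) - ln K"
    using K by (intro tendsto_intros p0) auto
  then have 2: "(\<lambda>m. (ln (1 - p (\<gamma> m)) - ln (p (\<gamma> m) / real m powr (- \<beta>))) / u_of (\<gamma> m)) \<longlonglongrightarrow> 0"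
    using inf by (rule tendsto_divide_0)
  have "w \<longlonglongrightarrow> 1 / 2 * (C - 0 - 2 * 0)" unfolding w_def by (intro tendsto_intros C 1 2)
  moreover have "\<forall>\<^sub>F m in sequentially. w m = ?b m / u_of (\<gamma> m)"
    using eventually_ge_at_top[of 1]
  proof eventually_elim
    case (elim m)
    then have g: "0 < p (\<gamma> m)" "p (\<gamma> m) < 1" "0 < u_of (\<gamma> m)" "0 < delta_of (\<gamma> m)"
      using adm by (auto simp: admissible_def u_of_def delta_of_def)
    have v: "ln (v_of (\<gamma> m)) = ln (u_of (\<gamma> m)) + 2 * (ln (1 - p (\<gamma> m)) - ln (p (\<gamma> m))) + 2 * ln (delta_of (\<gamma> m))"
      using g by (simp add: v_of_def f_of_def ln_mult ln_div ln_realpow)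
    have "ln (p (\<gamma> m) / real m powr (- \<beta>)) = ln (p (\<gamma> m)) + \<beta> * ln (real m)"
      using g elim by (simp add: ln_div ln_powr)
    then show ?case using g by (simp add: w_def v field_simps)
  qed
  ultimately have "(\<lambda>m. ?b m / u_of (\<gamma> m)) \<longlonglongrightarrow> 1 / 2 * (C - 0 - 2 * 0)"
    by (rule Lim_transform_eventually)
  then have 3: "(\<lambda>m. ?b m / u_of (\<gamma> m)) \<longlonglongrightarrow> C / 2" by simp
  have "\<forall>\<^sub>F m in sequentially. 0 < ?b m / u_of (\<gamma> m)" using order_tendstoD(1)[OF 3, of 0] C by simp
  then have "\<forall>\<^sub>F m in sequentially.
    (1 + ln (delta_of (\<gamma> m)) / ln (real m)) / (\<beta> + ln (delta_of (\<gamma> m)) / ln (real m)) * (?b m / u_of (\<gamma> m))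
      = ln (real m * delta_of (\<gamma> m)) / u_of (\<gamma> m)"
    using eventually_ge_at_top[of 2]
  proof eventually_elim
    case (elim m)
    then have g: "0 < u_of (\<gamma> m)" "0 < delta_of (\<gamma> m)"
      using adm by (auto simp: admissible_def u_of_def delta_of_def)
    define x where "x = ln (real m)"
    define y where "y = ln (delta_of (\<gamma> m))"
    have x: "0 < x" using elim by (simp add: x_def)
    have b: "\<beta> * x + y \<noteq> 0" using elim by (auto simp: x_def y_def)
    have "1 + y / x = (x + y) / x" "\<beta> + y / x = (\<beta> * x + y) / x"
      using x by (simp_all add: add_divide_distrib)
    then have "(1 + y / x) / (\<beta> + y / x) = (x + y) / (\<beta> * x + y)"
      using x by simp
    then have "(1 + y / x) / (\<beta> + y / x) * ((\<beta> * x + y) / u_of (\<gamma> m)) = (x + y) / u_of (\<gamma> m)"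
      using b by simp
    moreover have "ln (real m * delta_of (\<gamma> m)) = x + y"
      using g elim by (simp add: x_def y_def ln_mult)
    ultimately show ?case by (simp add: x_def y_def)
  qed
  with tendsto_mult[OF L(2) 3] have "(\<lambda>m. ln (real m * delta_of (\<gamma> m)) / u_of (\<gamma> m)) \<longlonglongrightarrow> L * (C / 2)"
    by (rule Lim_transform_eventually)
  then show ?thesis using L C by (intro exI[of _ "L * (C / 2)"]) auto
qed

theorem corollary4p1:
  fixes \<gamma> :: "nat \<Rightarrow> params" and C :: real
  assumes "\<forall>t\<ge>1. admissible (\<gamma> t)"
    and "(\<lambda>t. p (\<gamma> t)) \<longlonglongrightarrow> 0"
    and "filterlim (\<lambda>t. u_of (\<gamma> t)) at_top sequentially"
    and "filterlim (\<lambda>t. v_of (\<gamma> t)) at_top sequentially"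
    and "0 < C"
    and "(\<lambda>t. ln (v_of (\<gamma> t)) / u_of (\<gamma> t)) \<longlonglongrightarrow> C"
  shows
    "(\<forall>(m :: nat \<Rightarrow> nat) (\<alpha> :: nat \<Rightarrow> real) (c :: nat \<Rightarrow> real).
        (\<forall>t\<ge>1. m t \<ge> 1) \<and>
        (\<forall>t\<ge>1. 0 < \<alpha> t \<and> \<alpha> t < 1) \<and>
        asymp_proportional (\<lambda>t. odds (\<alpha> t)) (\<lambda>t. inverse (delta_of (\<gamma> t) * sqrt (u_of (\<gamma> t)))) \<and>
        (\<forall>\<^sub>F t in sequentially. 0 \<le> c t \<and> BFDR (\<gamma> t) (c t) = \<alpha> t)
        \<longrightarrow> ABOS m \<gamma> (\<lambda>t. fixed_threshold_rule (\<gamma> t) (c t)))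
     \<and>
     (\<forall>(\<beta> :: real) (C\<^sub>\<delta> :: ereal) (\<alpha> :: nat \<Rightarrow> real) (c :: nat \<Rightarrow> real).
        0 < \<beta> \<and>
        asymp_proportional (\<lambda>m. p (\<gamma> m)) (\<lambda>m. real m powr (- \<beta>)) \<and>
        0 \<le> C\<^sub>\<delta> \<and>
        ((\<lambda>m. ereal (ln (delta_of (\<gamma> m)) / ln (real m))) \<longlongrightarrow> C\<^sub>\<delta>) sequentially \<and>
        (\<forall>m\<ge>1. 0 < \<alpha> m \<and> \<alpha> m < 1) \<and>
        asymp_proportional (\<lambda>m. odds (\<alpha> m))
          (\<lambda>m. inverse (delta_of (\<gamma> m) * sqrt (ln (real m * delta_of (\<gamma> m))))) \<and>
        (\<forall>\<^sub>F m in sequentially. 0 \<le> c m \<and> BFDR (\<gamma> m) (c m) = \<alpha> m)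
        \<longrightarrow> ABOS (\<lambda>m. m) \<gamma> (\<lambda>m. fixed_threshold_rule (\<gamma> m) (c m)))"
proof (intro conjI allI impI; elim conjE)
  fix m :: "nat \<Rightarrow> nat" and \<alpha> c :: "nat \<Rightarrow> real"
  assume m: "\<forall>t\<ge>1. m t \<ge> 1"
    and ap: "asymp_proportional (\<lambda>t. odds (\<alpha> t)) (\<lambda>t. inverse (delta_of (\<gamma> t) * sqrt (u_of (\<gamma> t))))"
    and c: "\<forall>\<^sub>F t in sequentially. 0 \<le> c t \<and> BFDR (\<gamma> t) (c t) = \<alpha> t"
  obtain K where "0 < K" "(\<lambda>t. odds (\<alpha> t) * (delta_of (\<gamma> t) * sqrt (u_of (\<gamma> t)))) \<longlonglongrightarrow> K"
    using ap by (auto simp: asymp_proportional_def divide_inverse)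
  then show "ABOS m \<gamma> (\<lambda>t. fixed_threshold_rule (\<gamma> t) (c t))"
    by (rule ABOS_fixed_threshold[OF assms(1,3-6) m]) (use c in eventually_elim, auto)
next
  fix \<beta> :: real and C\<^sub>\<delta> :: ereal and \<alpha> c :: "nat \<Rightarrow> real"
  assume beta: "0 < \<beta>" "asymp_proportional (\<lambda>m. p (\<gamma> m)) (\<lambda>m. real m powr (- \<beta>))"
    and Cd: "0 \<le> C\<^sub>\<delta>" "((\<lambda>m. ereal (ln (delta_of (\<gamma> m)) / ln (real m))) \<longlongrightarrow> C\<^sub>\<delta>) sequentially"
    and ap: "asymp_proportional (\<lambda>m. odds (\<alpha> m))
          (\<lambda>m. inverse (delta_of (\<gamma> m) * sqrt (ln (real m * delta_of (\<gamma> m)))))"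
    and c: "\<forall>\<^sub>F m in sequentially. 0 \<le> c m \<and> BFDR (\<gamma> m) (c m) = \<alpha> m"
  let ?u = "\<lambda>m. u_of (\<gamma> m)" and ?d = "\<lambda>m. delta_of (\<gamma> m)" and ?l = "\<lambda>m. ln (real m * delta_of (\<gamma> m))"
  obtain K where K: "0 < K" "(\<lambda>m. odds (\<alpha> m) * (?d m * sqrt (?l m))) \<longlonglongrightarrow> K"
    using ap by (auto simp: asymp_proportional_def divide_inverse)
  obtain L where L: "0 < L" "(\<lambda>m. ?l m / ?u m) \<longlonglongrightarrow> L"
    using ln_m_delta_proportional[OF assms(1-3,5,6) beta Cd] by blast
  have lim: "(\<lambda>m. odds (\<alpha> m) * (?d m * sqrt (?l m)) / sqrt (?l m / ?u m)) \<longlonglongrightarrow> K / sqrt L"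
    using L(1) by (intro tendsto_divide K(2) tendsto_real_sqrt L(2)) auto
  have "\<forall>\<^sub>F m in sequentially. 0 < ?l m / ?u m" using order_tendstoD(1)[OF L(2,1)] .
  then have "\<forall>\<^sub>F m in sequentially. odds (\<alpha> m) * (?d m * sqrt (?l m)) / sqrt (?l m / ?u m)
      = odds (\<alpha> m) * (?d m * sqrt (?u m))"
    by eventually_elim (auto simp: real_sqrt_divide)
  with lim have "(\<lambda>m. odds (\<alpha> m) * (?d m * sqrt (?u m))) \<longlonglongrightarrow> K / sqrt L"
    by (rule Lim_transform_eventually)
  moreover have "0 < K / sqrt L" using K L by simp
  ultimately show "ABOS (\<lambda>m. m) \<gamma> (\<lambda>m. fixed_threshold_rule (\<gamma> m) (c m))"
    by (intro ABOS_fixed_threshold[OF assms(1,3-6)]) (use c in \<open>auto elim: eventually_mono\<close>)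
qed

end
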